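(* For a prime $p$ let $\mathbb{F}_p$ be the field with $p$ elements and $$E_{27A}(\mathbb{F}_p)=\{\infty\}\cup\{(x,y)\in\mathbb{F}_p\times\mathbb{F}_p: y^2+y=x^3-7\}.$$ Then for every prime $p$: $$\#E_{27A}(\mathbb{F}_p)\equiv0\pmod 9\quad\text{if } p\equiv1\pmod3,$$ $$\#E_{27A}(\mathbb{F}_p)=p+1\quad\text{if } p\equiv2\pmod3.$$
   Context: $\infty$ denotes a single extra point (the point at infinity of the elliptic curve $y^2+y=x^3-7$), and $\#$ denotes cardinality. *)

theory Defs
  imports "HOL-Number_Theory.Number_Theory"
begin

text \<open>
  The point at infinity is \<open>None\<close>; the constant 7 of the equation is
  \<open>[7] \<cdot>\<^bsub>R\<^esub> \<one>\<^bsub>R\<^esub>\<close>, the sum of seven copies of the unit of \<open>R\<close>.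
\<close>

definition E27A :: "('a, 'b) ring_scheme \<Rightarrow> ('a \<times> 'a) option set" where
  "E27A R = {None} \<union>
     Some ` {(x, y). x \<in> carrier R \<and> y \<in> carrier R \<and>
       y [^]\<^bsub>R\<^esub> (2::nat) \<oplus>\<^bsub>R\<^esub> y = x [^]\<^bsub>R\<^esub> (3::nat) \<ominus>\<^bsub>R\<^esub> ([(7::nat)] \<cdot>\<^bsub>R\<^esub> \<one>\<^bsub>R\<^esub>)}"

end

theory Submission
  imports Defs
begin

text \<open>
  Write \<open>N(c)\<close> for the number of cube roots of \<open>c\<close> modulo the prime \<open>p\<close>. Solving the
  equation of the curve for \<open>x\<close> gives \<open>1 + (\<Sum>y. N(y\<^sup>2 + y + 7))\<close> points. If
  \<open>p \<equiv> 2 (mod 3)\<close>, then \<open>3\<close> is prime to \<open>p - 1\<close>, so cubing permutes the residues, every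
  \<open>N(c)\<close> is \<open>1\<close>, and there are \<open>p + 1\<close> points.

  If \<open>p \<equiv> 1 (mod 3)\<close>, the curve is compared with the Fermat cubic \<open>s\<^sup>3 + z\<^sup>3 = 1\<close> by
  \<open>s = 1 - 9/(y + 5)\<close>, \<open>z = 3x/(y + 5)\<close>.
  This is an isomorphism of projective curves away from characteristic 3. It is bijective from
  the affine points with \<open>y \<noteq> -5\<close> onto the affine points with \<open>s \<noteq> 1\<close>
  (\<open>card_affine_points_outside_fibre\<close>). The only affine Fermat point with \<open>s = 1\<close> is
  \<open>(1, 0)\<close>, which is the image of \<open>\<infinity>\<close>, while the \<open>N(27)\<close> points with \<open>y = -5\<close> go to the
  Fermat points at infinity. Hence the curve has \<open>F + N(27)\<close> points, where \<open>F\<close> is the number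
  of affine Fermat points (\<open>card_affine_points\<close>).

  Sorting these by \<open>u = s\<^sup>3\<close> gives \<open>F = (\<Sum>u. N(u) N(1 - u))\<close>. Since there is a primitive
  cube root of unity, \<open>N(c)\<close> is \<open>0\<close> or \<open>3\<close> for every \<open>c \<noteq> 0\<close>. So all terms are divisible
  by \<open>9\<close> except those of \<open>u = 0\<close> and \<open>u = 1\<close>, which are both \<open>N(0) N(1) = 3\<close>. This yields
  \<open>F \<equiv> 6 (mod 9)\<close> (\<open>card_fermat_points_cong\<close>), and with \<open>N(27) = 3\<close> the total is \<open>0\<close>
  modulo \<open>9\<close>.
\<close>

section \<open>The curve as a set of pairs of residues\<close>

definition affine_points :: "int \<Rightarrow> (int \<times> int) set" where
  "affine_points P =
     {(x, y). x \<in> {0..<P} \<and> y \<in> {0..<P} \<and> [y\<^sup>2 + y = x ^ 3 - 7] (mod P)}"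

lemma (in residues) E27A_residue_ring: "E27A R = {None} \<union> Some ` affine_points m"
proof -
  have seven: "[(k::nat)] \<cdot> \<one> = int k mod m" for k
  proof (induct k)
    case 0
    show ?case by (simp add: res_zero_eq)
  next
    case (Suc k)
    then show ?case by (simp add: res_add_eq res_one_eq mod_simps add_ac)
  qed
  have "y [^] (2::nat) \<oplus> y = x [^] (3::nat) \<ominus> ([(7::nat)] \<cdot> \<one>)
          \<longleftrightarrow> [y\<^sup>2 + y = x ^ 3 - 7] (mod m)"
    if "x \<in> carrier R" "y \<in> carrier R" for x y
  proof -
    have pow: "u [^] n = u ^ n mod m" if "u \<in> carrier R" for u and n :: nat
      using pow_cong[of u n] that by (simp add: res_carrier_eq)
    show ?thesis
      unfolding pow[OF that(1)] pow[OF that(2)] seven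
      by (simp add: a_minus_def res_neg_eq res_add_eq cong_def mod_simps)
  qed
  then show ?thesis
    unfolding E27A_def affine_points_def by (auto simp: res_carrier_eq)
qed

section \<open>Counting cube roots modulo a prime\<close>

definition cube_roots :: "int \<Rightarrow> int \<Rightarrow> int set" where
  "cube_roots P c = {x \<in> {0..<P}. [x ^ 3 = c] (mod P)}"

lemma finite_cube_roots [simp]: "finite (cube_roots P c)"
  by (rule finite_subset[of _ "{0..<P}"]) (auto simp: cube_roots_def)

lemma cube_roots_cong: "[c = d] (mod P) \<Longrightarrow> cube_roots P c = cube_roots P d"
  by (auto simp: cube_roots_def intro: cong_trans cong_sym)

text \<open>
  For \<open>p = 3k + 2\<close>, Fermat's theorem gives \<open>u\<^bsup>2p-1\<^esup> = u\<close>, and \<open>2p - 1 = 3(2k + 1)\<close>;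
  hence raising to the power \<open>2k + 1\<close> inverts cubing.
\<close>
lemma cube_cong_imp_cong:
  fixes p :: nat and x y :: int
  assumes "prime p" "[p = 2] (mod 3)" "[x ^ 3 = y ^ 3] (mod p)"
  shows "[x = y] (mod p)"
proof -
  obtain k where k: "p = 3 * k + 2"
  proof
    show "p = 3 * (p div 3) + 2" using assms(2) by (simp add: cong_def) presburger
  qed
  interpret residues_prime p "residue_ring (int p)"
    by unfold_locales (use assms in auto)
  have fermat: "[u * (u ^ (p - 1)) ^ 2 = u] (mod p)" for u :: int
  proof (cases "int p dvd u")
    case True
    then show ?thesis by (simp add: cong_def mod_eq_0_iff_dvd)
  next
    case False
    then have "[u ^ totient (nat (int p)) = 1] (mod int p)"
      by (intro euler_theorem) (simp add: p_coprime_right_int)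
    then have "[u ^ (p - 1) = 1] (mod int p)"
      using assms(1) by (simp add: totient_prime)
    then have "[u * (u ^ (p - 1)) ^ 2 = u * 1 ^ 2] (mod int p)"
      by (intro cong_mult cong_pow cong_refl)
    then show ?thesis by simp
  qed
  have "u * (u ^ (p - 1)) ^ 2 = (u ^ 3) ^ (2 * k + 1)" for u :: int
  proof -
    have "u * (u ^ (p - 1)) ^ 2 = u ^ (1 + (p - 1) * 2)"
      by (simp only: power_add power_mult power_one_right)
    also have "1 + (p - 1) * 2 = 3 * (2 * k + 1)" using k by simp
    finally show ?thesis by (simp only: power_mult)
  qed
  with fermat have "[(u ^ 3) ^ (2 * k + 1) = u] (mod p)" for u :: int
    by metis
  with cong_pow[OF assms(3), of "2 * k + 1"] show ?thesis
    by (meson cong_sym cong_trans)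
qed

lemma card_cube_roots_eq_1:
  fixes p :: nat
  assumes "prime p" "[p = 2] (mod 3)"
  shows "card (cube_roots p c) = 1"
proof -
  have pos: "int p > 0" using assms(1) prime_gt_0_nat by simp
  let ?F = "{0..<int p}" and ?f = "\<lambda>x::int. x ^ 3 mod p"
  have "inj_on ?f ?F"
  proof (rule inj_onI)
    fix x y assume xy: "x \<in> ?F" "y \<in> ?F" "x ^ 3 mod p = y ^ 3 mod p"
    then have "[x ^ 3 = y ^ 3] (mod p)" by (simp add: cong_def)
    then have "[x = y] (mod p)" by (rule cube_cong_imp_cong[OF assms])
    with xy show "x = y" by (simp add: cong_def)
  qed
  moreover have "?f ` ?F \<subseteq> ?F" using pos by auto
  ultimately have surj: "?f ` ?F = ?F"
    by (intro endo_inj_surj) auto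
  have "c mod p \<in> ?f ` ?F" using pos by (subst surj) simp
  then obtain x :: int where x: "c mod p = x ^ 3 mod p" "x \<in> ?F" by (rule imageE)
  have "cube_roots p c = {u \<in> ?F. ?f u = ?f x}"
    by (simp add: cube_roots_def cong_def x(1))
  also have "\<dots> = {x}"
    using \<open>inj_on ?f ?F\<close> x(2) unfolding inj_on_def by blast
  finally have "cube_roots p c = {x}" .
  then show ?thesis by simp
qed

text \<open>
  The congruence \<open>w\<^sup>2 + w + 1 = 0\<close> is how a primitive cube root of unity is expressed. An element
  \<open>a\<close> of multiplicative order \<open>3\<close> satisfies it, being a zero of \<open>(a - 1)(a\<^sup>2 + a + 1)\<close> different
  from \<open>1\<close>; such elements exist because \<open>3\<close> divides \<open>p - 1\<close>.
\<close>
lemma ex_primitive_cube_root_of_unity: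
  fixes p :: nat
  assumes "prime p" "[p = 1] (mod 3)"
  obtains w :: int where "[w\<^sup>2 + w + 1 = 0] (mod p)"
proof -
  have "3 dvd p - 1"
    using assms cong_altdef_nat[of 1 p 3] prime_gt_1_nat[of p] by auto
  then have "card {x \<in> totatives p. ord p x = 3} = totient 3"
    using prime_card_elements_with_ord_eq_totient[OF prime_gt_1_nat[OF assms(1)] assms(1), of 3]
    by simp
  also have "\<dots> > 0" by simp
  finally obtain a where a: "ord p a = 3"
    by (metis (mono_tags, lifting) card.empty empty_Collect_eq less_irrefl)
  have "\<not> [a = 1] (mod p)" "[a ^ 3 = 1] (mod p)"
    using a ord_divides[of a 1 p] ord_divides[of a 3 p] by auto
  then have "\<not> [int a = 1] (mod p)" "[int a ^ 3 = 1] (mod p)"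
    by (metis cong_int_iff of_nat_1 of_nat_power)+
  then have "\<not> int p dvd int a - 1" "int p dvd (int a - 1) * ((int a)\<^sup>2 + int a + 1)"
    by (simp_all add: cong_iff_dvd_diff algebra_simps power2_eq_square power3_eq_cube)
  with assms(1) have "int p dvd (int a)\<^sup>2 + int a + 1"
    by (simp add: prime_dvd_mult_iff)
  then show ?thesis by (intro that[of "int a"]) (simp add: cong_0_iff)
qed

text \<open>
  If \<open>w\<close> is a primitive cube root of unity, then \<open>x\<^sup>3 - a\<^sup>3\<close> splits into the linear factors
  \<open>x - a\<close>, \<open>x - wa\<close>, \<open>x - w\<^sup>2a\<close>; over the integers the product of these factors differs
  from \<open>x\<^sup>3 - a\<^sup>3\<close> by an explicit multiple of \<open>w\<^sup>2 + w + 1\<close>.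
\<close>
lemma cube_cong_cases:
  fixes P w a x :: int
  assumes "prime P" "[w\<^sup>2 + w + 1 = 0] (mod P)"
  shows "[x ^ 3 = a ^ 3] (mod P) \<longleftrightarrow>
         [x = a] (mod P) \<or> [x = w * a] (mod P) \<or> [x = w\<^sup>2 * a] (mod P)"
proof -
  have "x ^ 3 - a ^ 3 = (x - a) * ((x - w * a) * (x - w\<^sup>2 * a)) +
      (w\<^sup>2 + w + 1) * ((x - a) * (a * x - (w - 1) * a\<^sup>2))"
    by (simp add: algebra_simps power2_eq_square power3_eq_cube)
  moreover have "P dvd (w\<^sup>2 + w + 1) * ((x - a) * (a * x - (w - 1) * a\<^sup>2))"
    using assms(2) by (simp add: cong_0_iff)
  ultimately have "P dvd x ^ 3 - a ^ 3 \<longleftrightarrow> P dvd (x - a) * ((x - w * a) * (x - w\<^sup>2 * a))"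
    by (metis dvd_add_left_iff)
  then show ?thesis
    using assms(1) by (simp add: cong_iff_dvd_diff prime_dvd_mult_iff)
qed

text \<open>
  The residues \<open>a\<close>, \<open>wa\<close>, \<open>w\<^sup>2a\<close> are distinct because their differences are products of the
  units \<open>a\<close>, \<open>w\<close>, \<open>w + 1\<close> and \<open>w - 1\<close>. The last one is a unit because \<open>w\<^sup>2 + w + 1\<close> takes
  the value \<open>3\<close> at \<open>w = 1\<close>.
\<close>
lemma card_cube_roots_cube:
  fixes P w a :: int
  assumes "prime P" "[w\<^sup>2 + w + 1 = 0] (mod P)" "\<not> P dvd 3" "\<not> P dvd a"
  shows "card (cube_roots P (a ^ 3)) = 3"
proof -
  have pos: "P > 0" using assms(1) by (simp add: prime_gt_0_int)
  have w0: "P dvd w\<^sup>2 + w + 1" using assms(2) by (simp add: cong_0_iff)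
  have w1: "\<not> P dvd w - 1"
  proof
    assume "P dvd w - 1"
    then have "P dvd (w\<^sup>2 + w + 1) - (w - 1) * (w + 2)" using w0 by simp
    also have "(w\<^sup>2 + w + 1) - (w - 1) * (w + 2) = 3" by (simp add: algebra_simps power2_eq_square)
    finally show False using assms(3) by simp
  qed
  have w: "\<not> P dvd w"
  proof
    assume "P dvd w"
    then have "P dvd (w\<^sup>2 + w + 1) - w * (w + 1)" using w0 by simp
    also have "(w\<^sup>2 + w + 1) - w * (w + 1) = 1" by (simp add: algebra_simps power2_eq_square)
    finally show False using assms(1) by (simp add: not_prime_unit)
  qed
  have w2: "\<not> P dvd w + 1"
  proof
    assume "P dvd w + 1"
    then have "P dvd (w\<^sup>2 + w + 1) - w * (w + 1)" using w0 by simp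
    also have "(w\<^sup>2 + w + 1) - w * (w + 1) = 1" by (simp add: algebra_simps power2_eq_square)
    finally show False using assms(1) by (simp add: not_prime_unit)
  qed
  have "cube_roots P (a ^ 3) = {a mod P, w * a mod P, w\<^sup>2 * a mod P}"
  proof -
    have "x \<in> cube_roots P (a ^ 3) \<longleftrightarrow> x \<in> {a mod P, w * a mod P, w\<^sup>2 * a mod P}" for x
    proof -
      have residue: "x \<in> {0..<P} \<and> [x = b] (mod P) \<longleftrightarrow> x = b mod P" for b
        using pos by (auto simp: cong_def)
      show ?thesis
        using residue[of a] residue[of "w * a"] residue[of "w\<^sup>2 * a"]
        unfolding cube_roots_def cube_cong_cases[OF assms(1,2)] by blast
    qed
    then show ?thesis by blast
  qed
  moreover have "\<not> P dvd a - w * a" "\<not> P dvd a - w\<^sup>2 * a" "\<not> P dvd w * a - w\<^sup>2 * a"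
  proof -
    have "a - w * a = - (w - 1) * a" "a - w\<^sup>2 * a = - (w - 1) * (w + 1) * a"
      "w * a - w\<^sup>2 * a = - (w - 1) * w * a"
      by (simp_all add: algebra_simps power2_eq_square)
    then show "\<not> P dvd a - w * a" "\<not> P dvd a - w\<^sup>2 * a" "\<not> P dvd w * a - w\<^sup>2 * a"
      using w w1 w2 assms(1,4) by (simp_all only: prime_dvd_mult_iff dvd_minus_iff) auto
  qed
  ultimately show ?thesis
    by (simp add: mod_eq_dvd_iff)
qed

lemma card_cube_roots_0:
  fixes P :: int
  assumes "prime P" "[c = 0] (mod P)"
  shows "card (cube_roots P c) = 1"
proof -
  have "cube_roots P c = cube_roots P 0" using assms(2) by (rule cube_roots_cong)
  also have "\<dots> = {0}"
    using assms(1) by (auto simp: cube_roots_def cong_0_iff prime_dvd_power_iff prime_gt_0_int zdvd_not_zless le_less)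
  finally show ?thesis by simp
qed

text \<open>If \<open>c\<close> has a cube root \<open>a\<close>, its cube roots are the three residues \<open>a\<close>, \<open>wa\<close>, \<open>w\<^sup>2a\<close>.\<close>
lemma three_dvd_card_cube_roots:
  fixes P w c :: int
  assumes "prime P" "[w\<^sup>2 + w + 1 = 0] (mod P)" "\<not> P dvd 3" "\<not> P dvd c"
  shows "3 dvd card (cube_roots P c)"
proof (cases "cube_roots P c = {}")
  case False
  then obtain a where a: "[a ^ 3 = c] (mod P)" by (auto simp: cube_roots_def)
  then have "\<not> P dvd a"
    using assms(4) cong_dvd_iff[OF a] by (auto simp: dvd_power_iff intro: dvd_trans)
  then show ?thesis
    using card_cube_roots_cube[OF assms(1-3), of a] cube_roots_cong[OF a] by simp
qed simp

section \<open>Points on the Fermat cubic\<close>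

definition fermat_points :: "int \<Rightarrow> (int \<times> int) set" where
  "fermat_points P = {(s, z). s \<in> {0..<P} \<and> z \<in> {0..<P} \<and> [s ^ 3 + z ^ 3 = 1] (mod P)}"

text \<open>The index \<open>u\<close> is the value of \<open>s\<^sup>3\<close>.\<close>
lemma card_fermat_points_fibres:
  "card (fermat_points P) = (\<Sum>u\<in>{0..<P}. card (cube_roots P u) * card (cube_roots P (1 - u)))"
proof -
  have *: "[s ^ 3 + z ^ 3 = 1] (mod P) \<longleftrightarrow> [z ^ 3 = 1 - s ^ 3] (mod P)" for s z :: int
    by (simp add: cong_iff_dvd_diff algebra_simps)
  have "fermat_points P = (\<Union>u\<in>{0..<P}. cube_roots P u \<times> cube_roots P (1 - u))"
  proof (cases "P > 0")
    case True
    have "(s, z) \<in> fermat_points P \<longleftrightarrow>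
        (\<exists>u\<in>{0..<P}. s \<in> cube_roots P u \<and> z \<in> cube_roots P (1 - u))" for s z
    proof
      assume sz: "(s, z) \<in> fermat_points P"
      have "[s ^ 3 = s ^ 3 mod P] (mod P)" by simp
      moreover have "[z ^ 3 = 1 - s ^ 3 mod P] (mod P)"
        using sz * by (simp add: fermat_points_def cong_def mod_simps)
      ultimately show "\<exists>u\<in>{0..<P}. s \<in> cube_roots P u \<and> z \<in> cube_roots P (1 - u)"
        using True sz by (intro bexI[of _ "s ^ 3 mod P"]) (auto simp: fermat_points_def cube_roots_def)
    next
      assume "\<exists>u\<in>{0..<P}. s \<in> cube_roots P u \<and> z \<in> cube_roots P (1 - u)"
      then obtain u where u: "s \<in> cube_roots P u" "z \<in> cube_roots P (1 - u)" by blast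
      then have "[s ^ 3 + z ^ 3 = u + (1 - u)] (mod P)"
        by (intro cong_add) (auto simp: cube_roots_def)
      with u show "(s, z) \<in> fermat_points P"
        by (simp add: fermat_points_def cube_roots_def)
    qed
    then show ?thesis by auto
  qed (auto simp: fermat_points_def)
  also have "card \<dots> = (\<Sum>u\<in>{0..<P}. card (cube_roots P u \<times> cube_roots P (1 - u)))"
  proof (intro card_UN_disjoint ballI impI)
    fix u v assume "u \<in> {0..<P}" "v \<in> {0..<P}" "u \<noteq> v"
    then have "cube_roots P u \<inter> cube_roots P v = {}"
      by (auto simp: cube_roots_def cong_def)
    then show "cube_roots P u \<times> cube_roots P (1 - u) \<inter> cube_roots P v \<times> cube_roots P (1 - v) = {}"
      by blast
  qed simp_all
  finally show ?thesis by (simp add: card_cartesian_product)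
qed

text \<open>
  The terms \<open>u = 0\<close> and \<open>u = 1\<close> of the sum contribute \<open>3\<close> each; in all others both factors
  count cube roots of a nonzero residue, so their product is a multiple of \<open>9\<close>.
\<close>
lemma card_fermat_points_cong:
  fixes P w :: int
  assumes "prime P" "[w\<^sup>2 + w + 1 = 0] (mod P)" "\<not> P dvd 3"
  shows "[card (fermat_points P) = 6] (mod 9)"
proof -
  have P: "P > 1" using assms(1) prime_gt_1_int by blast
  let ?g = "\<lambda>u. card (cube_roots P u) * card (cube_roots P (1 - u))"
  have N1: "card (cube_roots P 1) = 3"
    using card_cube_roots_cube[OF assms, of 1] P by simp
  have N0: "card (cube_roots P 0) = 1"
    by (rule card_cube_roots_0[OF assms(1)]) simp
  have "{0..<P} = {2..<P} \<union> {0, 1}" using P by auto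
  then have "card (fermat_points P) = (\<Sum>u\<in>{2..<P}. ?g u) + 6"
    unfolding card_fermat_points_fibres
    by (simp only:) (subst sum.union_disjoint; simp add: N0 N1)
  moreover have "9 dvd (\<Sum>u\<in>{2..<P}. ?g u)"
  proof (rule dvd_sum)
    fix u assume u: "u \<in> {2..<P}"
    then have "\<not> P dvd u" by (simp add: zdvd_not_zless)
    moreover have "\<not> P dvd 1 - u"
      using u zdvd_not_zless[of "u - 1" P] by (simp add: dvd_diff_commute)
    ultimately have "3 * 3 dvd ?g u"
      by (intro mult_dvd_mono three_dvd_card_cube_roots[OF assms])
    then show "9 dvd ?g u" by simp
  qed
  then obtain k where "(\<Sum>u\<in>{2..<P}. ?g u) = 9 * k" by (rule dvdE)
  ultimately show ?thesis by (simp add: cong_def)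
qed

section \<open>Comparing the curve with the Fermat cubic\<close>

text \<open>
  This reduces a consequence of two congruences to a polynomial identity over the integers with
  known cofactors \<open>k\<close> and \<open>l\<close>.
\<close>
lemma cong_linear_combination:
  fixes P :: int
  assumes "[a = b] (mod P)" "[c = d] (mod P)" "e - f = (a - b) * k + (c - d) * l"
  shows "[e = f] (mod P)"
  using assms by (simp add: cong_iff_dvd_diff)

text \<open>
  The map \<open>(x, y) \<mapsto> (1 - 9/(y + 5), 3x/(y + 5))\<close> has the inverse
  \<open>(s, z) \<mapsto> (3z/(1 - s), 9/(1 - s) - 5)\<close>. It respects the equations because, with
  \<open>m = y + 5\<close>,
  \<open>y\<^sup>2 + y + 7 = m\<^sup>2 - 9m + 27 = (m/3)\<^sup>3 (1 - (1 - 9/m)\<^sup>3)\<close>,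
  so that \<open>x\<^sup>3 = y\<^sup>2 + y + 7\<close> says \<open>z\<^sup>3 = 1 - s\<^sup>3\<close> for \<open>z = 3x/m\<close> and \<open>s = 1 - 9/m\<close>.
\<close>
lemma card_affine_points_outside_fibre:
  fixes P :: int
  assumes "prime P" "\<not> P dvd 3"
  shows "card {(x, y) \<in> affine_points P. \<not> [y = -5] (mod P)} =
         card {(s, z) \<in> fermat_points P. s \<noteq> 1}"
proof -
  have P: "P > 1" using assms(1) prime_gt_1_int by blast
  have cop: "coprime a P" if "\<not> P dvd a" for a
    using that assms(1) by (metis coprime_commute prime_imp_coprime)
  let ?inv = "modular_inverse P"
  let ?A = "{(x, y) \<in> affine_points P. \<not> [y = -5] (mod P)}"
  let ?B = "{(s, z) \<in> fermat_points P. s \<noteq> 1}"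
  let ?f = "\<lambda>(x, y). ((1 - 9 * ?inv (y + 5)) mod P, (3 * x * ?inv (y + 5)) mod P)"
  let ?g = "\<lambda>(s, z). ((3 * z * ?inv (1 - s)) mod P, (9 * ?inv (1 - s) - 5) mod P)"
  have inv: "[a * ?inv b = 1] (mod P)" if "[a = b] (mod P)" "\<not> [a = 0] (mod P)" for a b
  proof -
    have "\<not> P dvd b" using that cong_dvd_iff[OF that(1)] by (simp add: cong_0_iff)
    then have "[b * ?inv b = 1] (mod P)" by (intro cong_modular_inverse1 cop)
    with cong_scalar_right[OF that(1)] show ?thesis by (rule cong_trans)
  qed
  have nine: "\<not> P dvd 9"
    using assms prime_dvd_mult_iff[OF assms(1), of 3 3] by simp
  \<comment> \<open>In both halves \<open>i\<close> is \<open>1/(y + 5)\<close> and \<open>j\<close> is \<open>1/(1 - s)\<close>. They are related by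
    \<open>9ij = 1\<close>, because \<open>(y + 5)(1 - s) = 9\<close>.\<close>
  have f: "?f (x, y) \<in> ?B \<and> ?g (?f (x, y)) = (x, y)" if xy: "(x, y) \<in> ?A" for x y
  proof -
    define i where "i = ?inv (y + 5)"
    define s where "s = (1 - 9 * i) mod P"
    define z where "z = (3 * x * i) mod P"
    define j where "j = ?inv (1 - s)"
    have "\<not> [y + 5 = 0] (mod P)" using xy by (simp add: cong_iff_dvd_diff)
    then have i: "[(y + 5) * i = 1] (mod P)" unfolding i_def by (intro inv) simp_all
    then have "\<not> P dvd 9 * i"
      using nine assms(1) cong_dvd_iff[OF i] P
      by (auto simp: prime_dvd_mult_iff zdvd_not_zless)
    have s: "[s = 1 - 9 * i] (mod P)" and z: "[z = 3 * x * i] (mod P)"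
      by (simp_all add: s_def z_def)
    have w: "[9 * i = 1 - s] (mod P)"
      using cong_diff[OF cong_refl[of 1] s] by (simp add: cong_sym_eq)
    then have j: "[9 * i * j = 1] (mod P)"
      unfolding j_def using \<open>\<not> P dvd 9 * i\<close> by (intro inv) (simp_all add: cong_0_iff)
    have curve: "[y\<^sup>2 + y = x ^ 3 - 7] (mod P)" using xy by (simp add: affine_points_def)
    have "[s ^ 3 + z ^ 3 = (1 - 9 * i) ^ 3 + (3 * x * i) ^ 3] (mod P)"
      by (intro cong_add cong_pow s z)
    also have "[(1 - 9 * i) ^ 3 + (3 * x * i) ^ 3 = 1] (mod P)"
      by (rule cong_linear_combination[OF i curve, of _ _ "27 * i * ((y + 5) * i + 1 - 9 * i)" "-27 * i ^ 3"])
        (simp add: algebra_simps power2_eq_square power3_eq_cube)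
    finally have "[s ^ 3 + z ^ 3 = 1] (mod P)" .
    moreover have "s \<noteq> 1"
    proof
      assume "s = 1"
      with w \<open>\<not> P dvd 9 * i\<close> show False by (simp add: cong_0_iff)
    qed
    moreover have "[3 * z * j = x] (mod P)"
      by (rule cong_linear_combination[OF z j, of _ _ "3 * j" "x"])
        (simp add: algebra_simps power2_eq_square power3_eq_cube)
    moreover have "[9 * j - 5 = y] (mod P)"
      by (rule cong_linear_combination[OF i j, of _ _ "-9 * j" "y + 5"])
        (simp add: algebra_simps power2_eq_square power3_eq_cube)
    moreover have "s \<in> {0..<P}" "z \<in> {0..<P}" using P by (simp_all add: s_def z_def)
    moreover have "x \<in> {0..<P}" "y \<in> {0..<P}" using xy by (simp_all add: affine_points_def)
    ultimately have "(s, z) \<in> ?B \<and> ?g (s, z) = (x, y)"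
      by (simp add: fermat_points_def cong_def flip: j_def)
    then show ?thesis by (simp add: s_def z_def i_def)
  qed
  have g: "?g (s, z) \<in> ?A \<and> ?f (?g (s, z)) = (s, z)" if sz: "(s, z) \<in> ?B" for s z
  proof -
    define j where "j = ?inv (1 - s)"
    define x where "x = (3 * z * j) mod P"
    define y where "y = (9 * j - 5) mod P"
    define i where "i = ?inv (y + 5)"
    have range: "s \<in> {0..<P}" "z \<in> {0..<P}" using sz by (simp_all add: fermat_points_def)
    have "\<not> [1 - s = 0] (mod P)"
    proof
      assume "[1 - s = 0] (mod P)"
      then have "[s = 1] (mod P)" by (simp add: cong_iff_dvd_diff dvd_diff_commute)
      with range P have "s = 1" by (simp add: cong_def)
      with sz show False by simp
    qed
    then have j: "[(1 - s) * j = 1] (mod P)" unfolding j_def by (intro inv) simp_all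
    then have "\<not> P dvd 9 * j"
      using nine assms(1) cong_dvd_iff[OF j] P
      by (auto simp: prime_dvd_mult_iff zdvd_not_zless)
    have x: "[x = 3 * z * j] (mod P)" and y: "[y = 9 * j - 5] (mod P)"
      by (simp_all add: x_def y_def)
    have m: "[9 * j = y + 5] (mod P)"
      using cong_add[OF y cong_refl[of 5]] by (simp add: cong_sym_eq)
    then have i: "[9 * j * i = 1] (mod P)"
      unfolding i_def using \<open>\<not> P dvd 9 * j\<close> by (intro inv) (simp_all add: cong_0_iff)
    have fermat: "[s ^ 3 + z ^ 3 = 1] (mod P)" using sz by (simp add: fermat_points_def)
    have "[y\<^sup>2 + y = (9 * j - 5)\<^sup>2 + (9 * j - 5)] (mod P)"
      by (intro cong_add cong_pow y)
    also have "[(9 * j - 5)\<^sup>2 + (9 * j - 5) = (3 * z * j) ^ 3 - 7] (mod P)"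
      by (rule cong_linear_combination[OF j fermat, of _ _ "-27 * (3 * j\<^sup>2 - 3 * j * (1 + (1 - s) * j) + 1 + (1 - s) * j + ((1 - s) * j)\<^sup>2)" "-27 * j ^ 3"])
        (simp add: algebra_simps power2_eq_square power3_eq_cube)
    also have "[(3 * z * j) ^ 3 - 7 = x ^ 3 - 7] (mod P)"
      by (intro cong_diff cong_pow cong_sym[OF x] cong_refl)
    finally have "[y\<^sup>2 + y = x ^ 3 - 7] (mod P)" .
    moreover have "\<not> [y = -5] (mod P)"
      using cong_dvd_iff[OF m] \<open>\<not> P dvd 9 * j\<close> by (simp add: cong_iff_dvd_diff)
    moreover have "[1 - 9 * i = s] (mod P)"
      by (rule cong_linear_combination[OF i j, of _ _ "- (1 - s)" "9 * i"])
        (simp add: algebra_simps power2_eq_square power3_eq_cube)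
    moreover have "[3 * x * i = z] (mod P)"
      by (rule cong_linear_combination[OF x i, of _ _ "3 * i" "z"])
        (simp add: algebra_simps power2_eq_square power3_eq_cube)
    moreover have "x \<in> {0..<P}" "y \<in> {0..<P}" using P by (simp_all add: x_def y_def)
    ultimately have "(x, y) \<in> ?A \<and> ?f (x, y) = (s, z)"
      using range by (simp add: affine_points_def cong_def flip: i_def)
    then show ?thesis by (simp add: x_def y_def j_def)
  qed
  have "bij_betw ?f ?A ?B"
  proof (rule bij_betw_byWitness[where f' = ?g])
    have f': "?f u \<in> ?B \<and> ?g (?f u) = u" if "u \<in> ?A" for u
      using f[of "fst u" "snd u"] that by (simp only: prod.collapse)
    have g': "?g u \<in> ?A \<and> ?f (?g u) = u" if "u \<in> ?B" for u
      using g[of "fst u" "snd u"] that by (simp only: prod.collapse)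
    show "\<forall>u\<in>?A. ?g (?f u) = u" by (intro ballI conjunct2[OF f'])
    show "\<forall>u\<in>?B. ?f (?g u) = u" by (intro ballI conjunct2[OF g'])
    show "?f ` ?A \<subseteq> ?B" by (intro image_subsetI conjunct1[OF f'])
    show "?g ` ?B \<subseteq> ?A" by (intro image_subsetI conjunct1[OF g'])
  qed
  then show ?thesis by (rule bij_betw_same_card)
qed

text \<open>
  The comparison leaves out the points with \<open>y = -5\<close>, where \<open>y\<^sup>2 + y + 7 = 27\<close>, on the curve
  and the single point \<open>(1, 0)\<close> on the Fermat cubic.
\<close>
lemma card_affine_points:
  fixes P :: int
  assumes "prime P" "\<not> P dvd 3"
  shows "card (affine_points P) + 1 = card (fermat_points P) + card (cube_roots P 27)"
proof -
  have P: "P > 1" using assms(1) prime_gt_1_int by blast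
  let ?A = "{(x, y) \<in> affine_points P. \<not> [y = -5] (mod P)}"
  let ?B = "{(s, z) \<in> fermat_points P. s \<noteq> 1}"
  have fin: "finite (affine_points P)" "finite (fermat_points P)"
    by (rule finite_subset[of _ "{0..<P} \<times> {0..<P}"];
        auto simp: affine_points_def fermat_points_def)+
  have "affine_points P - ?A = (\<lambda>x. (x, -5 mod P)) ` cube_roots P 27"
  proof -
    have "(x, y) \<in> affine_points P - ?A \<longleftrightarrow> x \<in> cube_roots P 27 \<and> y = -5 mod P" for x y
    proof -
      have "[y\<^sup>2 + y = x ^ 3 - 7] (mod P) \<longleftrightarrow> [x ^ 3 = 27] (mod P)" if "[y = -5] (mod P)"
      proof -
        have "[y\<^sup>2 + y = (-5)\<^sup>2 + -5] (mod P)" by (intro cong_add cong_pow that)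
        then have "[y\<^sup>2 + y = x ^ 3 - 7] (mod P) \<longleftrightarrow> [20 = x ^ 3 - 7] (mod P)"
          by (simp add: cong_def)
        also have "\<dots> \<longleftrightarrow> [x ^ 3 = 27] (mod P)"
          by (simp add: cong_iff_dvd_diff dvd_diff_commute)
        finally show ?thesis .
      qed
      moreover have "y \<in> {0..<P} \<and> [y = -5] (mod P) \<longleftrightarrow> y = -5 mod P"
        using P by (auto simp: cong_def)
      ultimately show ?thesis
        by (auto simp: affine_points_def cube_roots_def)
    qed
    then show ?thesis by auto
  qed
  then have "card (affine_points P - ?A) = card (cube_roots P 27)"
    by (simp add: card_image inj_on_def)
  moreover have "card (affine_points P) = card ?A + card (affine_points P - ?A)"
    using fin by (subst card_Un_disjoint[symmetric]) (auto intro: arg_cong[where f = card] rev_finite_subset)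
  moreover have "fermat_points P - ?B = {(1, 0)}"
  proof -
    have "z = 0" if "z \<in> {0..<P}" "[1 + z ^ 3 = 1] (mod P)" for z
      using that assms(1) by (auto simp: cong_iff_dvd_diff prime_dvd_power_iff zdvd_not_zless le_less)
    with P show ?thesis by (auto simp: fermat_points_def)
  qed
  then have "card (fermat_points P - ?B) = 1" by simp
  moreover have "card (fermat_points P) = card ?B + card (fermat_points P - ?B)"
    using fin by (subst card_Un_disjoint[symmetric]) (auto intro: arg_cong[where f = card] rev_finite_subset)
  ultimately show ?thesis
    using card_affine_points_outside_fibre[OF assms] by simp
qed

section \<open>The number of points\<close>

lemma card_fibres:
  assumes "finite A" "\<And>a. a \<in> A \<Longrightarrow> finite (B a)"
  shows "card {(a, b). a \<in> A \<and> b \<in> B a} = (\<Sum>a\<in>A. card (B a))"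
proof -
  have "{(a, b). a \<in> A \<and> b \<in> B a} = Sigma A B" by auto
  then show ?thesis using assms by simp
qed

lemma card_affine_points_fibres:
  "card (affine_points P) = (\<Sum>y\<in>{0..<P}. card (cube_roots P (y\<^sup>2 + y + 7)))"
proof -
  have *: "[y\<^sup>2 + y = x ^ 3 - 7] (mod P) \<longleftrightarrow> [x ^ 3 = y\<^sup>2 + y + 7] (mod P)" for x y
  proof -
    have "y\<^sup>2 + y - (x ^ 3 - 7) = - (x ^ 3 - (y\<^sup>2 + y + 7))" by simp
    then show ?thesis by (simp only: cong_iff_dvd_diff dvd_minus_iff)
  qed
  have "affine_points P = prod.swap ` {(y, x). y \<in> {0..<P} \<and> x \<in> cube_roots P (y\<^sup>2 + y + 7)}"
    by (force simp: affine_points_def cube_roots_def *)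
  then have "card (affine_points P) = card {(y, x). y \<in> {0..<P} \<and> x \<in> cube_roots P (y\<^sup>2 + y + 7)}"
    by (simp add: card_image)
  also have "\<dots> = (\<Sum>y\<in>{0..<P}. card (cube_roots P (y\<^sup>2 + y + 7)))"
    by (rule card_fibres) simp_all
  finally show ?thesis .
qed

theorem corollary3p2:
  fixes p :: nat
  assumes "prime p"
  shows "([p = 1] (mod 3) \<longrightarrow> [card (E27A (residue_ring (int p))) = 0] (mod 9)) \<and>
         ([p = 2] (mod 3) \<longrightarrow> card (E27A (residue_ring (int p))) = p + 1)"
proof -
  interpret residues "int p" "residue_ring (int p)"
    by unfold_locales (use assms prime_gt_1_nat in auto)
  have "finite (affine_points p)"
    by (rule finite_subset[of _ "{0..<int p} \<times> {0..<int p}"]) (auto simp: affine_points_def)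
  then have E: "card (E27A (residue_ring (int p))) = card (affine_points p) + 1"
    unfolding E27A_residue_ring by (simp add: card_image)
  show ?thesis
  proof (intro conjI impI)
    assume p: "[p = 1] (mod 3)"
    obtain w where w: "[w\<^sup>2 + w + 1 = 0] (mod int p)"
      using ex_primitive_cube_root_of_unity[OF assms p] .
    have P: "prime (int p)" using assms by simp
    have "p \<noteq> 3" using p by (auto simp: cong_def)
    then have three: "\<not> int p dvd 3"
      using primes_dvd_imp_eq[OF assms, of 3] int_dvd_int_iff[of p 3] by auto
    have "card (cube_roots p (3 ^ 3)) = 3"
      by (rule card_cube_roots_cube[OF P w three three])
    then have "card (E27A (residue_ring (int p))) = card (fermat_points p) + 3"
      using card_affine_points[OF P three] E by simp
    also have "[\<dots> = 6 + 3] (mod 9)"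
      by (intro cong_add card_fermat_points_cong[OF P w three] cong_refl)
    finally show "[card (E27A (residue_ring (int p))) = 0] (mod 9)"
      by (simp add: cong_def)
  next
    assume p: "[p = 2] (mod 3)"
    show "card (E27A (residue_ring (int p))) = p + 1"
      unfolding E card_affine_points_fibres by (simp add: card_cube_roots_eq_1[OF assms p])
  qed
qed

end
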